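(* Let $\alpha<0$, let $f\in D_\alpha$ satisfy $f(0)\neq 0$, and for each integer $n\ge 0$ let $p_n$ be the optimal approximant of order $n$ to $1/f$ in $D_\alpha$. Let $\mathcal{Z}(p_n)=\{z\in\mathbb{C}: p_n(z)=0\}$ and $\overline{D}(0,2^{\alpha/2})=\{z\in\mathbb{C}:|z|\le 2^{\alpha/2}\}$. Then $\mathcal{Z}(p_n)\cap\overline{D}(0,2^{\alpha/2})=\varnothing$ for all $n$.
   Context: $\mathbb{D}=\{z\in\mathbb{C}:|z|<1\}$. For $\alpha\in\mathbb{R}$, the Dirichlet-type space $D_\alpha$ consists of all analytic functions $f=\sum_{k\ge 0}a_kz^k$ on $\mathbb{D}$ with $\|f\|_\alpha^2=\sum_{k=0}^\infty (k+1)^\alpha|a_k|^2<\infty$; it is a Hilbert space with inner product $\langle f,g\rangle_\alpha=\sum_{k=0}^\infty (k+1)^\alpha a_k\overline{b_k}$ for $g=\sum_{k\ge0} b_kz^k$. Let $\mathcal{P}_n$ be the space of complex polynomials of degree at most $n$. For $f\in D_\alpha$, the optimal approximant of order $n$ to $1/f$ (in $D_\alpha$) is the unique $p_n\in\mathcal{P}_n$ minimizing $\|pf-1\|_\alpha$ over all $p\in\mathcal{P}_n$; equivalently, $p_nf$ is the orthogonal projection in $D_\alpha$ of the constant function $1$ onto $f\cdot\mathcal{P}_n=\{pf:p\in\mathcal{P}_n\}$. *)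

theory Defs
  imports "HOL-Complex_Analysis.Complex_Analysis"
begin

text \<open>
  Functions on the open unit disc are total functions \<open>complex \<Rightarrow> complex\<close>; their values off the disc
  play no role, since the coefficients \<open>a\<^sub>k\<close> are those of the Taylor expansion at 0.
\<close>

abbreviation taylor_coeff :: "(complex \<Rightarrow> complex) \<Rightarrow> nat \<Rightarrow> complex" where
  "taylor_coeff f k \<equiv> fps_nth (fps_expansion f 0) k"

definition dirichlet_space :: "real \<Rightarrow> (complex \<Rightarrow> complex) set" where
  "dirichlet_space \<alpha> =
     {f. f analytic_on ball 0 1 \<and>
         summable (\<lambda>k. real (k + 1) powr \<alpha> * (cmod (taylor_coeff f k))\<^sup>2)}"

text \<open>Meaningful only for \<open>f \<in> dirichlet_space \<alpha>\<close>: otherwise the series may diverge.\<close>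

definition dirichlet_norm :: "real \<Rightarrow> (complex \<Rightarrow> complex) \<Rightarrow> real" where
  "dirichlet_norm \<alpha> f =
     sqrt (\<Sum>k. real (k + 1) powr \<alpha> * (cmod (taylor_coeff f k))\<^sup>2)"

definition is_optimal_approximant ::
    "real \<Rightarrow> (complex \<Rightarrow> complex) \<Rightarrow> nat \<Rightarrow> complex poly \<Rightarrow> bool" where
  "is_optimal_approximant \<alpha> f n p \<longleftrightarrow>
     degree p \<le> n \<and>
     (\<forall>q. degree q \<le> n \<longrightarrow>
        dirichlet_norm \<alpha> (\<lambda>z. poly p z * f z - 1) \<le> dirichlet_norm \<alpha> (\<lambda>z. poly q z * f z - 1))"

text \<open>
  The description is proper for \<open>f \<in> dirichlet_space \<alpha>\<close> with \<open>f 0 \<noteq> 0\<close>: the minimizer then exists and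
  is unique. For \<open>f\<close> vanishing on the disc every polynomial of degree at most \<open>n\<close> is a minimizer.
\<close>

definition optimal_approximant ::
    "real \<Rightarrow> (complex \<Rightarrow> complex) \<Rightarrow> nat \<Rightarrow> complex poly" where
  "optimal_approximant \<alpha> f n = (THE p. is_optimal_approximant \<alpha> f n p)"

end

theory Submission
  imports Defs
begin

text \<open>
  Everything happens on Taylor series, with the orthogonal decomposition
  \<open>\<parallel>q f - 1\<parallel>\<^sup>2 = \<parallel>p f - 1\<parallel>\<^sup>2 + \<parallel>(q - p) f\<parallel>\<^sup>2\<close> identifying the optimal approximant as the polynomial
  \<open>p\<close> with \<open>p f - 1 \<bottom> f \<cdot> P\<^sub>n\<close>. If \<open>p(\<zeta>) = 0\<close>, write \<open>p = (z - \<zeta>) q\<close> and \<open>g = q f\<close>. Then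
  \<open>z g \<in> f \<cdot> P\<^sub>n\<close> is orthogonal to \<open>p f - 1\<close> and, having no constant term, to \<open>1\<close>; hence it is
  orthogonal to \<open>p f = z g - \<zeta> g\<close>, and Pythagoras gives
  \<open>|\<zeta>|\<^sup>2 \<parallel>g\<parallel>\<^sup>2 = \<parallel>z g\<parallel>\<^sup>2 + \<parallel>p f\<parallel>\<^sup>2 > \<parallel>z g\<parallel>\<^sup>2 \<ge> 2\<^sup>\<alpha> \<parallel>g\<parallel>\<^sup>2\<close>.
\<close>

section \<open>Weighted square-summable coefficient sequences, as formal power series\<close>

definition dirichlet_fps :: "real \<Rightarrow> complex fps set" where
  "dirichlet_fps \<alpha> = {a. summable (\<lambda>k. real (k + 1) powr \<alpha> * (cmod (fps_nth a k))\<^sup>2)}"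

definition fps_sqnorm :: "real \<Rightarrow> complex fps \<Rightarrow> real" where
  "fps_sqnorm \<alpha> a = (\<Sum>k. real (k + 1) powr \<alpha> * (cmod (fps_nth a k))\<^sup>2)"

definition fps_inner :: "real \<Rightarrow> complex fps \<Rightarrow> complex fps \<Rightarrow> complex" where
  "fps_inner \<alpha> a b = (\<Sum>k. of_real (real (k + 1) powr \<alpha>) * (fps_nth a k * cnj (fps_nth b k)))"

text \<open>Termwise \<open>x * y \<le> x\<^sup>2 + y\<^sup>2\<close> dominates the series by the
  sum of the two norm series. Every algebraic law of \<open>fps_inner\<close> below rests on this
  convergence.\<close>

lemma summable_fps_inner:
  assumes "a \<in> dirichlet_fps \<alpha>" "b \<in> dirichlet_fps \<alpha>"
  shows "summable (\<lambda>k. of_real (real (k + 1) powr \<alpha>) * (fps_nth a k * cnj (fps_nth b k)))"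
proof (rule summable_comparison_test')
  let ?w = "\<lambda>k. real (k + 1) powr \<alpha>"
  show "summable (\<lambda>k. ?w k * (cmod (fps_nth a k))\<^sup>2 + ?w k * (cmod (fps_nth b k))\<^sup>2)"
    using assms by (intro summable_add) (simp_all add: dirichlet_fps_def)
  fix k
  have "x * y \<le> x\<^sup>2 + y\<^sup>2" for x y :: real
    using sum_squares_bound[of x y] zero_le_power2[of x] zero_le_power2[of y] by linarith
  then have "?w k * (cmod (fps_nth a k) * cmod (fps_nth b k))
      \<le> ?w k * ((cmod (fps_nth a k))\<^sup>2 + (cmod (fps_nth b k))\<^sup>2)"
    by (intro mult_left_mono) auto
  then show "norm (of_real (?w k) * (fps_nth a k * cnj (fps_nth b k)))
      \<le> ?w k * (cmod (fps_nth a k))\<^sup>2 + ?w k * (cmod (fps_nth b k))\<^sup>2"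
    by (simp add: norm_mult distrib_left del: of_nat_add)
qed

lemma dirichlet_fps_add:
  assumes "a \<in> dirichlet_fps \<alpha>" "b \<in> dirichlet_fps \<alpha>"
  shows "a + b \<in> dirichlet_fps \<alpha>"
  unfolding dirichlet_fps_def mem_Collect_eq
proof (rule summable_comparison_test')
  let ?w = "\<lambda>k. real (k + 1) powr \<alpha>"
  show "summable (\<lambda>k. 2 * (?w k * (cmod (fps_nth a k))\<^sup>2 + ?w k * (cmod (fps_nth b k))\<^sup>2))"
    using assms by (intro summable_mult summable_add) (simp_all add: dirichlet_fps_def)
  fix k
  let ?x = "cmod (fps_nth a k)" and ?y = "cmod (fps_nth b k)"
  have "(cmod (fps_nth a k + fps_nth b k))\<^sup>2 \<le> (?x + ?y)\<^sup>2"
    by (intro power_mono norm_triangle_ineq) auto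
  also have "\<dots> \<le> 2 * (?x\<^sup>2 + ?y\<^sup>2)"
    using sum_squares_bound[of ?x ?y] by (simp add: power2_sum)
  finally have "?w k * (cmod (fps_nth a k + fps_nth b k))\<^sup>2 \<le> ?w k * (2 * (?x\<^sup>2 + ?y\<^sup>2))"
    by (intro mult_left_mono) auto
  then show "norm (?w k * (cmod (fps_nth (a + b) k))\<^sup>2) \<le> 2 * (?w k * ?x\<^sup>2 + ?w k * ?y\<^sup>2)"
    by (simp add: algebra_simps del: of_nat_add)
qed

lemma dirichlet_fps_const_mult:
  assumes "a \<in> dirichlet_fps \<alpha>"
  shows "fps_const c * a \<in> dirichlet_fps \<alpha>"
  using summable_mult[of "\<lambda>k. real (k + 1) powr \<alpha> * (cmod (fps_nth a k))\<^sup>2" "(cmod c)\<^sup>2"] assms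
  by (simp add: dirichlet_fps_def norm_mult power_mult_distrib mult_ac)

lemma dirichlet_fps_diff:
  assumes "a \<in> dirichlet_fps \<alpha>" "b \<in> dirichlet_fps \<alpha>"
  shows "a - b \<in> dirichlet_fps \<alpha>"
proof -
  have "fps_const (-1) * b = - b"
    by (rule fps_ext) simp
  then show ?thesis
    using dirichlet_fps_add[OF assms(1) dirichlet_fps_const_mult[OF assms(2), of "-1"]] by simp
qed

lemma dirichlet_fps_0: "0 \<in> dirichlet_fps \<alpha>"
  by (simp add: dirichlet_fps_def)

lemma dirichlet_fps_1: "1 \<in> dirichlet_fps \<alpha>"
  unfolding dirichlet_fps_def mem_Collect_eq
  by (rule summable_finite[of "{0}"]) auto

text \<open>For \<open>\<alpha> \<le> 0\<close> the weights do not increase, so moving each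
  coefficient one place up cannot enlarge its term.\<close>

lemma dirichlet_fps_X_mult:
  assumes "\<alpha> \<le> 0" "a \<in> dirichlet_fps \<alpha>"
  shows "fps_X * a \<in> dirichlet_fps \<alpha>"
proof -
  have "summable (\<lambda>k. real (Suc k + 1) powr \<alpha> * (cmod (fps_nth (fps_X * a) (Suc k)))\<^sup>2)"
  proof (rule summable_comparison_test')
    show "summable (\<lambda>k. real (k + 1) powr \<alpha> * (cmod (fps_nth a k))\<^sup>2)"
      using assms(2) by (simp add: dirichlet_fps_def)
    fix k
    have "real (Suc k + 1) powr \<alpha> \<le> real (k + 1) powr \<alpha>"
      using assms(1) by (intro powr_mono2') auto
    then show "norm (real (Suc k + 1) powr \<alpha> * (cmod (fps_nth (fps_X * a) (Suc k)))\<^sup>2)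
        \<le> real (k + 1) powr \<alpha> * (cmod (fps_nth a k))\<^sup>2"
      by (simp add: mult_right_mono)
  qed
  then show ?thesis
    unfolding dirichlet_fps_def mem_Collect_eq by (subst (asm) summable_Suc_iff)
qed

lemma dirichlet_fps_poly_mult:
  assumes "\<alpha> \<le> 0" "a \<in> dirichlet_fps \<alpha>"
  shows "fps_of_poly p * a \<in> dirichlet_fps \<alpha>"
proof (induction p)
  case 0
  then show ?case by (simp add: dirichlet_fps_0)
next
  case (pCons c p)
  have "fps_of_poly (pCons c p) * a = fps_const c * a + fps_X * (fps_of_poly p * a)"
    by (simp add: fps_of_poly_pCons algebra_simps)
  then show ?case
    using dirichlet_fps_add[OF dirichlet_fps_const_mult[OF assms(2)]
        dirichlet_fps_X_mult[OF assms(1) pCons.IH]] by simp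
qed

section \<open>Sesquilinearity of the pairing, the induced norm and Pythagoras\<close>

lemma fps_inner_add_left:
  assumes "a \<in> dirichlet_fps \<alpha>" "b \<in> dirichlet_fps \<alpha>" "c \<in> dirichlet_fps \<alpha>"
  shows "fps_inner \<alpha> (a + b) c = fps_inner \<alpha> a c + fps_inner \<alpha> b c"
  unfolding fps_inner_def
  by (subst suminf_add[OF summable_fps_inner summable_fps_inner]) (use assms in \<open>simp_all add: algebra_simps\<close>)

lemma fps_inner_diff_left:
  assumes "a \<in> dirichlet_fps \<alpha>" "b \<in> dirichlet_fps \<alpha>" "c \<in> dirichlet_fps \<alpha>"
  shows "fps_inner \<alpha> (a - b) c = fps_inner \<alpha> a c - fps_inner \<alpha> b c"
  using fps_inner_add_left[OF dirichlet_fps_diff[OF assms(1,2)] assms(2,3)] by simp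

lemma fps_inner_const_mult_left:
  assumes "a \<in> dirichlet_fps \<alpha>" "b \<in> dirichlet_fps \<alpha>"
  shows "fps_inner \<alpha> (fps_const c * a) b = c * fps_inner \<alpha> a b"
  unfolding fps_inner_def
  by (subst suminf_mult[symmetric, OF summable_fps_inner[OF assms]]) (simp add: mult_ac)

lemma fps_inner_commute:
  assumes "a \<in> dirichlet_fps \<alpha>" "b \<in> dirichlet_fps \<alpha>"
  shows "fps_inner \<alpha> a b = cnj (fps_inner \<alpha> b a)"
proof -
  have "(\<lambda>k. cnj (of_real (real (k + 1) powr \<alpha>) * (fps_nth b k * cnj (fps_nth a k))))
      sums cnj (fps_inner \<alpha> b a)"
    unfolding sums_cnj fps_inner_def by (rule summable_sums[OF summable_fps_inner[OF assms(2,1)]])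
  then show ?thesis
    unfolding fps_inner_def[of \<alpha> a b] by (simp add: sums_iff mult_ac)
qed

lemma fps_inner_add_right:
  assumes "a \<in> dirichlet_fps \<alpha>" "b \<in> dirichlet_fps \<alpha>" "c \<in> dirichlet_fps \<alpha>"
  shows "fps_inner \<alpha> c (a + b) = fps_inner \<alpha> c a + fps_inner \<alpha> c b"
  by (metis assms complex_cnj_add dirichlet_fps_add fps_inner_add_left fps_inner_commute)

lemma fps_inner_const_mult_right:
  assumes "a \<in> dirichlet_fps \<alpha>" "b \<in> dirichlet_fps \<alpha>"
  shows "fps_inner \<alpha> b (fps_const c * a) = cnj c * fps_inner \<alpha> b a"
  by (metis assms complex_cnj_mult dirichlet_fps_const_mult fps_inner_const_mult_left fps_inner_commute)

lemma fps_inner_self: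
  assumes "a \<in> dirichlet_fps \<alpha>"
  shows "fps_inner \<alpha> a a = of_real (fps_sqnorm \<alpha> a)"
proof -
  have "summable (\<lambda>k. real (k + 1) powr \<alpha> * (cmod (fps_nth a k))\<^sup>2)"
    using assms by (simp add: dirichlet_fps_def)
  then have "(\<lambda>k. complex_of_real (real (k + 1) powr \<alpha> * (cmod (fps_nth a k))\<^sup>2))
      sums of_real (fps_sqnorm \<alpha> a)"
    unfolding fps_sqnorm_def by (intro sums_of_real summable_sums)
  then show ?thesis
    unfolding fps_inner_def of_real_mult complex_norm_square by (rule sums_unique[symmetric])
qed

lemma fps_inner_1_left: "fps_inner \<alpha> 1 a = cnj (fps_nth a 0)"
  unfolding fps_inner_def by (subst suminf_finite[of "{0}"]) auto

lemma fps_sqnorm_nonneg: "a \<in> dirichlet_fps \<alpha> \<Longrightarrow> 0 \<le> fps_sqnorm \<alpha> a"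
  unfolding fps_sqnorm_def dirichlet_fps_def by (rule suminf_nonneg) auto

lemma fps_sqnorm_eq_0_iff:
  assumes "a \<in> dirichlet_fps \<alpha>"
  shows "fps_sqnorm \<alpha> a = 0 \<longleftrightarrow> a = 0"
  using assms unfolding fps_sqnorm_def dirichlet_fps_def mem_Collect_eq
  by (subst suminf_eq_zero_iff) (auto simp: fps_eq_iff simp del: of_nat_add)

lemma fps_sqnorm_const_mult:
  assumes "a \<in> dirichlet_fps \<alpha>"
  shows "fps_sqnorm \<alpha> (fps_const c * a) = (cmod c)\<^sup>2 * fps_sqnorm \<alpha> a"
proof -
  have "summable (\<lambda>k. real (k + 1) powr \<alpha> * (cmod (fps_nth a k))\<^sup>2)"
    using assms by (simp add: dirichlet_fps_def)
  then show ?thesis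
    unfolding fps_sqnorm_def
    by (subst suminf_mult[symmetric]) (simp_all add: norm_mult power_mult_distrib mult_ac)
qed

lemma fps_sqnorm_add_orthogonal:
  assumes "a \<in> dirichlet_fps \<alpha>" "b \<in> dirichlet_fps \<alpha>" "fps_inner \<alpha> a b = 0"
  shows "fps_sqnorm \<alpha> (a + b) = fps_sqnorm \<alpha> a + fps_sqnorm \<alpha> b"
proof -
  have "fps_inner \<alpha> b a = 0"
    using assms fps_inner_commute[of b \<alpha> a] by simp
  then have "fps_inner \<alpha> (a + b) (a + b) = fps_inner \<alpha> a a + fps_inner \<alpha> b b"
    using assms by (simp add: fps_inner_add_left fps_inner_add_right dirichlet_fps_add)
  then show ?thesis
    using assms by (simp add: fps_inner_self dirichlet_fps_add flip: of_real_add)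
qed

text \<open>Consecutive weights have ratio \<open>((k + 2) / (k + 1)) powr \<alpha>\<close>, which
  is least at \<open>k = 0\<close>, where it is \<open>2 powr \<alpha>\<close>. This is the source
  of the radius \<open>2 powr (\<alpha> / 2)\<close>.\<close>

lemma fps_sqnorm_X_mult_ge:
  assumes "\<alpha> \<le> 0" "a \<in> dirichlet_fps \<alpha>"
  shows "2 powr \<alpha> * fps_sqnorm \<alpha> a \<le> fps_sqnorm \<alpha> (fps_X * a)"
proof -
  let ?h = "\<lambda>k. real (k + 1) powr \<alpha> * (cmod (fps_nth (fps_X * a) k))\<^sup>2"
  have a: "summable (\<lambda>k. real (k + 1) powr \<alpha> * (cmod (fps_nth a k))\<^sup>2)"
    using assms(2) by (simp add: dirichlet_fps_def)
  have h: "summable ?h"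
    using dirichlet_fps_X_mult[OF assms] by (simp add: dirichlet_fps_def)
  have "2 powr \<alpha> * fps_sqnorm \<alpha> a
      = (\<Sum>k. 2 powr \<alpha> * (real (k + 1) powr \<alpha> * (cmod (fps_nth a k))\<^sup>2))"
    unfolding fps_sqnorm_def by (rule suminf_mult[OF a, symmetric])
  also have "\<dots> \<le> (\<Sum>k. ?h (Suc k))"
  proof (intro suminf_le summable_mult a)
    show "summable (\<lambda>k. ?h (Suc k))"
      using h by (subst summable_Suc_iff)
    fix k
    \<comment> \<open>Here \<open>k + 2 \<le> 2 * (k + 1)\<close>, and a nonpositive exponent
      reverses the inequality.\<close>
    have "(2 * real (k + 1)) powr \<alpha> \<le> real (Suc k + 1) powr \<alpha>"
      using assms(1) by (intro powr_mono2') auto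
    then have "2 powr \<alpha> * real (k + 1) powr \<alpha> \<le> real (Suc k + 1) powr \<alpha>"
      by (subst (asm) powr_mult) auto
    then show "2 powr \<alpha> * (real (k + 1) powr \<alpha> * (cmod (fps_nth a k))\<^sup>2) \<le> ?h (Suc k)"
      by (simp add: mult_right_mono flip: mult.assoc)
  qed
  also have "\<dots> = fps_sqnorm \<alpha> (fps_X * a)"
    unfolding fps_sqnorm_def by (subst suminf_split_head[OF h]) simp
  finally show ?thesis .
qed

section \<open>Orthogonal projection onto the polynomial multiples of \<open>F\<close>\<close>

text \<open>Gram-Schmidt, one dimension at a time. Coefficients vanishing from \<open>n\<close> on,
  rather than a degree bound, let the induction start at the zero space. The vector \<open>u\<close>
  is arbitrary because the induction hypothesis serves both \<open>u\<close> and the new generator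
  \<open>fps_of_poly (monom 1 n) * F\<close>.\<close>

lemma exists_orthogonal_projection:
  assumes "\<alpha> \<le> 0" "F \<in> dirichlet_fps \<alpha>" "u \<in> dirichlet_fps \<alpha>"
  shows "\<exists>p. (\<forall>k\<ge>n. coeff p k = 0) \<and>
           (\<forall>q. (\<forall>k\<ge>n. coeff q k = 0) \<longrightarrow>
              fps_inner \<alpha> (u - fps_of_poly p * F) (fps_of_poly q * F) = 0)"
  using assms(3)
proof (induction n arbitrary: u)
  case 0
  have "q = 0" if "\<forall>k. coeff q k = 0" for q :: "complex poly"
    using that by (simp add: poly_eq_iff)
  then show ?case
    by (intro exI[of _ 0]) (fastforce simp: fps_inner_def)
next
  case (Suc n)
  note mem = dirichlet_fps_poly_mult[OF assms(1,2)]
  obtain p1 where p1: "\<And>k. k \<ge> n \<Longrightarrow> coeff p1 k = 0"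
    and orth1: "\<And>q. \<forall>k\<ge>n. coeff q k = 0 \<Longrightarrow>
      fps_inner \<alpha> (u - fps_of_poly p1 * F) (fps_of_poly q * F) = 0"
    using Suc.IH[OF Suc.prems] by blast
  obtain p2 where p2: "\<And>k. k \<ge> n \<Longrightarrow> coeff p2 k = 0"
    and orth2: "\<And>q. \<forall>k\<ge>n. coeff q k = 0 \<Longrightarrow>
      fps_inner \<alpha> (fps_of_poly (monom 1 n) * F - fps_of_poly p2 * F) (fps_of_poly q * F) = 0"
    using Suc.IH[OF mem] by blast
  define m where "m = monom 1 n - p2"
  \<comment> \<open>\<open>w\<close> is the part of the new generator orthogonal to the old space,
    \<open>r\<close> the residual of \<open>u\<close> there, and \<open>c * w\<close> the projection
    of \<open>r\<close> onto \<open>w\<close>. If \<open>w = 0\<close>, division by zero makes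
    \<open>c = 0\<close>, which is harmless.\<close>
  define w where "w = fps_of_poly m * F"
  define r where "r = u - fps_of_poly p1 * F"
  define c where "c = fps_inner \<alpha> r w / fps_inner \<alpha> w w"
  have w: "w \<in> dirichlet_fps \<alpha>" and r: "r \<in> dirichlet_fps \<alpha>"
    by (simp_all add: w_def r_def mem Suc.prems dirichlet_fps_diff)
  have c: "c * fps_inner \<alpha> w w = fps_inner \<alpha> r w"
  proof (cases "fps_inner \<alpha> w w = 0")
    case True
    then have "w = 0"
      using fps_inner_self[OF w] fps_sqnorm_eq_0_iff[OF w] by simp
    then show ?thesis
      by (simp add: fps_inner_def)
  qed (simp add: c_def)
  show ?case
  proof (intro exI[of _ "p1 + smult c m"] conjI allI impI)
    fix k assume "Suc n \<le> k"
    then show "coeff (p1 + smult c m) k = 0"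
      by (simp add: m_def p1 p2)
  next
    fix q :: "complex poly" assume q: "\<forall>k\<ge>Suc n. coeff q k = 0"
    define d where "d = coeff q n"
    \<comment> \<open>The coefficient of \<open>m\<close> at \<open>n\<close> is 1, so this
      subtraction removes the top coefficient of \<open>q\<close>. Testing against \<open>q\<close>
      then splits into testing against \<open>w\<close> and against the old space.\<close>
    define q' where "q' = q - smult d m"
    have q': "\<forall>k\<ge>n. coeff q' k = 0"
    proof (intro allI impI)
      fix k assume "n \<le> k"
      then show "coeff q' k = 0"
        using q p2 by (cases "k = n") (simp_all add: q'_def d_def m_def)
    qed
    have "fps_of_poly m * F = fps_of_poly (monom 1 n) * F - fps_of_poly p2 * F"
      by (simp add: m_def fps_of_poly_diff algebra_simps)
    then have orth_w: "fps_inner \<alpha> w (fps_of_poly q' * F) = 0"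
      using orth2[OF q'] by (simp add: w_def)
    have orth_r: "fps_inner \<alpha> r (fps_of_poly q' * F) = 0"
      using orth1[OF q'] by (simp add: r_def)
    have "fps_of_poly q * F = fps_const d * w + fps_of_poly q' * F"
      by (simp add: q'_def w_def fps_of_poly_diff fps_of_poly_smult algebra_simps)
    moreover have "u - fps_of_poly (p1 + smult c m) * F = r - fps_const c * w"
      by (simp add: r_def w_def fps_of_poly_add fps_of_poly_smult algebra_simps)
    ultimately show "fps_inner \<alpha> (u - fps_of_poly (p1 + smult c m) * F) (fps_of_poly q * F) = 0"
      using w r orth_w orth_r c
      by (simp add: fps_inner_add_right fps_inner_diff_left fps_inner_const_mult_left
          fps_inner_const_mult_right dirichlet_fps_const_mult dirichlet_fps_diff mem)
  qed
qed

section \<open>From functions to Taylor series, and the optimal approximant as a projection\<close>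

lemma has_fps_expansion_poly:
  fixes p :: "complex poly"
  shows "poly p has_fps_expansion fps_of_poly p"
proof (induction p)
  case (pCons c p)
  have "(\<lambda>z. c + z * poly p z) has_fps_expansion fps_const c + fps_X * fps_of_poly p"
    by (intro fps_expansion_intros pCons.IH)
  also have "(\<lambda>z. c + z * poly p z) = poly (pCons c p)"
    by auto
  finally show ?case
    by (simp add: fps_of_poly_pCons mult.commute)
qed simp

lemma dirichlet_norm_poly_mult_minus_1:
  assumes "f analytic_on {0}"
  shows "dirichlet_norm \<alpha> (\<lambda>z. poly p z * f z - 1)
    = sqrt (fps_sqnorm \<alpha> (fps_of_poly p * fps_expansion f 0 - 1))"
proof -
  have "f has_fps_expansion fps_expansion f 0"
    using assms by (rule analytic_at_imp_has_fps_expansion_0)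
  then have "(\<lambda>z. poly p z * f z - 1) has_fps_expansion fps_of_poly p * fps_expansion f 0 - 1"
    by (intro fps_expansion_intros has_fps_expansion_poly)
  then have "fps_expansion (\<lambda>z. poly p z * f z - 1) 0 = fps_of_poly p * fps_expansion f 0 - 1"
    by (rule fps_expansion_eqI)
  then show ?thesis
    by (simp add: dirichlet_norm_def fps_sqnorm_def)
qed

text \<open>The projection \<open>p0\<close> of 1 is a minimizer by Pythagoras, and the only one
  because \<open>F \<noteq> 0\<close>. So the definite description in
  \<open>optimal_approximant\<close> denotes \<open>p0\<close> and inherits its
  orthogonality.\<close>

lemma optimal_approximant_properties:
  fixes n :: nat and f :: "complex \<Rightarrow> complex"
  assumes "\<alpha> \<le> 0" "f \<in> dirichlet_space \<alpha>" "f 0 \<noteq> 0"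
  defines "F \<equiv> fps_expansion f 0"
  defines "p \<equiv> optimal_approximant \<alpha> f n"
  shows degree_optimal_approximant: "degree p \<le> n"
    and optimal_approximant_orthogonal:
      "degree q \<le> n \<Longrightarrow> fps_inner \<alpha> (1 - fps_of_poly p * F) (fps_of_poly q * F) = 0"
proof -
  have F: "F \<in> dirichlet_fps \<alpha>" and f: "f analytic_on {0}"
    using assms(2) by (auto simp: F_def dirichlet_space_def dirichlet_fps_def intro: analytic_on_subset)
  note mem = dirichlet_fps_poly_mult[OF assms(1) F]
  have "F \<noteq> 0"
    using assms(3) by (auto simp: F_def fps_expansion_def fps_eq_iff intro!: exI[of _ 0])
  \<comment> \<open>Degree at most \<open>n\<close> means \<open>n + 1\<close> free coefficients,
    hence the projection lemma is used at \<open>Suc n\<close>.\<close>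
  have deg: "degree q \<le> n \<longleftrightarrow> (\<forall>k\<ge>Suc n. coeff q k = 0)" for q :: "complex poly"
    by (metis Suc_le_eq coeff_eq_0 degree_le le_less_trans)
  obtain p0 where p0: "degree p0 \<le> n"
    and orth: "\<And>q. degree q \<le> n \<Longrightarrow>
      fps_inner \<alpha> (1 - fps_of_poly p0 * F) (fps_of_poly q * F) = 0"
    using exists_orthogonal_projection[OF assms(1) F dirichlet_fps_1, of "Suc n"]
    unfolding deg by blast
  have pythagoras: "fps_sqnorm \<alpha> (fps_of_poly q * F - 1)
      = fps_sqnorm \<alpha> (1 - fps_of_poly p0 * F) + fps_sqnorm \<alpha> (fps_of_poly (p0 - q) * F)"
    if "degree q \<le> n" for q
  proof -
    have "fps_of_poly q * F - 1
        = fps_const (-1) * ((1 - fps_of_poly p0 * F) + fps_of_poly (p0 - q) * F)"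
      by (simp add: fps_of_poly_diff algebra_simps flip: fps_const_neg)
    moreover have "degree (p0 - q) \<le> n"
      using p0 that by (rule degree_diff_le)
    ultimately show ?thesis
      by (simp add: fps_sqnorm_const_mult fps_sqnorm_add_orthogonal orth mem dirichlet_fps_1
          dirichlet_fps_add dirichlet_fps_diff)
  qed
  have norm_eq: "dirichlet_norm \<alpha> (\<lambda>z. poly q z * f z - 1)
      = sqrt (fps_sqnorm \<alpha> (1 - fps_of_poly p0 * F) + fps_sqnorm \<alpha> (fps_of_poly (p0 - q) * F))"
    if "degree q \<le> n" for q
    using pythagoras[OF that] by (simp add: dirichlet_norm_poly_mult_minus_1[OF f] F_def)
  have zero: "fps_sqnorm \<alpha> 0 = 0"
    by (simp add: fps_sqnorm_def)
  have opt: "is_optimal_approximant \<alpha> f n p0"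
    by (simp add: is_optimal_approximant_def p0 norm_eq zero fps_sqnorm_nonneg mem)
  \<comment> \<open>A second minimizer leaves no room for the term with \<open>p0 - q\<close>, so
    \<open>(p0 - q) F = 0\<close>; power series over the complex numbers have no zero
    divisors.\<close>
  have "q = p0" if "is_optimal_approximant \<alpha> f n q" for q
  proof -
    have "degree q \<le> n" and "dirichlet_norm \<alpha> (\<lambda>z. poly q z * f z - 1)
        \<le> dirichlet_norm \<alpha> (\<lambda>z. poly p0 z * f z - 1)"
      using that p0 by (auto simp: is_optimal_approximant_def)
    then have "fps_sqnorm \<alpha> (fps_of_poly (p0 - q) * F) \<le> 0"
      by (simp add: norm_eq p0 zero)
    then have "fps_of_poly (p0 - q) * F = 0"
      using fps_sqnorm_nonneg[OF mem] fps_sqnorm_eq_0_iff[OF mem] by (metis antisym)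
    then show ?thesis
      using \<open>F \<noteq> 0\<close> by (simp add: fps_of_poly_diff fps_of_poly_eq_iff)
  qed
  with opt have "p = p0"
    unfolding p_def optimal_approximant_def by (rule the_equality)
  then show "degree p \<le> n"
    and "degree q \<le> n \<Longrightarrow> fps_inner \<alpha> (1 - fps_of_poly p * F) (fps_of_poly q * F) = 0"
    using p0 orth by simp_all
qed

section \<open>Location of the zeros\<close>

theorem theoremB:
  fixes \<alpha> :: real and f :: "complex \<Rightarrow> complex"
  assumes "\<alpha> < 0"
    and "f \<in> dirichlet_space \<alpha>"
    and "f 0 \<noteq> 0"
  shows "\<forall>n. {z. poly (optimal_approximant \<alpha> f n) z = 0} \<inter> cball 0 (2 powr (\<alpha> / 2)) = {}"
proof -
  have "2 powr (\<alpha> / 2) < cmod \<zeta>" if root: "poly (optimal_approximant \<alpha> f n) \<zeta> = 0" for n \<zeta>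
  proof -
    define p where "p = optimal_approximant \<alpha> f n"
    define F where "F = fps_expansion f 0"
    have \<alpha>: "\<alpha> \<le> 0"
      using assms(1) by simp
    have deg: "degree p \<le> n"
      and orth: "\<And>q. degree q \<le> n \<Longrightarrow>
        fps_inner \<alpha> (1 - fps_of_poly p * F) (fps_of_poly q * F) = 0"
      using degree_optimal_approximant[OF \<alpha> assms(2,3)]
        optimal_approximant_orthogonal[OF \<alpha> assms(2,3)]
      by (simp_all add: p_def F_def)
    have F: "F \<in> dirichlet_fps \<alpha>"
      using assms(2) by (simp add: F_def dirichlet_space_def dirichlet_fps_def)
    have F0: "fps_nth F 0 \<noteq> 0"
      using assms(3) by (simp add: F_def fps_expansion_def)
    \<comment> \<open>With \<open>p = 0\<close>, orthogonality against the test polynomial 1 would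
      give \<open>cnj (fps_nth F 0) = 0\<close>.\<close>
    have "p \<noteq> 0"
      using orth[of 1] F0 by (auto simp: fps_inner_1_left)
    obtain q where p_eq: "p = [:- \<zeta>, 1:] * q"
      using root by (auto simp: p_def poly_eq_0_iff_dvd elim: dvdE)
    with \<open>p \<noteq> 0\<close> have "q \<noteq> 0"
      by auto
    \<comment> \<open>\<open>pCons 0 q\<close> is \<open>z q\<close>, of the same degree as
      \<open>p\<close>, hence an admissible test polynomial.\<close>
    then have "degree (pCons 0 q) \<le> n"
      using deg unfolding p_eq by (subst (asm) degree_mult_eq) auto
    define G where "G = fps_of_poly q * F"
    have G: "G \<in> dirichlet_fps \<alpha>" and "G \<noteq> 0"
      using \<open>q \<noteq> 0\<close> F0 fps_of_poly_eq_iff[of q 0]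
      by (auto simp: G_def dirichlet_fps_poly_mult[OF \<alpha> F])
    have XG: "fps_X * G \<in> dirichlet_fps \<alpha>"
      by (rule dirichlet_fps_X_mult[OF \<alpha> G])
    have pF: "fps_of_poly p * F \<in> dirichlet_fps \<alpha>"
      by (rule dirichlet_fps_poly_mult[OF \<alpha> F])
    have "fps_of_poly p * F = fps_X * G - fps_const \<zeta> * G"
      unfolding p_eq fps_of_poly_mult fps_of_poly_linear
      by (simp add: G_def algebra_simps flip: fps_const_neg)
    \<comment> \<open>Arranged as a sum of two orthogonal terms, so that Pythagoras applies to
      \<open>\<zeta> G\<close>.\<close>
    then have decomp: "fps_const (-1) * (fps_of_poly p * F) + fps_X * G = fps_const \<zeta> * G"
      by (simp flip: fps_const_neg)
    have "fps_inner \<alpha> (1 - fps_of_poly p * F) (fps_X * G) = 0"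
      using orth[OF \<open>degree (pCons 0 q) \<le> n\<close>] by (simp add: fps_of_poly_pCons G_def mult_ac)
    then have "fps_inner \<alpha> (fps_of_poly p * F) (fps_X * G) = 0"
      by (simp add: fps_inner_diff_left dirichlet_fps_1 pF XG fps_inner_1_left)
    then have "(cmod \<zeta>)\<^sup>2 * fps_sqnorm \<alpha> G
        = fps_sqnorm \<alpha> (fps_of_poly p * F) + fps_sqnorm \<alpha> (fps_X * G)"
      using fps_sqnorm_add_orthogonal[of "fps_const (-1) * (fps_of_poly p * F)" \<alpha> "fps_X * G"]
      unfolding decomp
      by (simp add: fps_sqnorm_const_mult fps_inner_const_mult_left dirichlet_fps_const_mult G XG pF)
    \<comment> \<open>Strict positivity here is what excludes zeros on the boundary circle as
      well.\<close>
    moreover have "fps_sqnorm \<alpha> (fps_of_poly p * F) > 0"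
      using fps_sqnorm_nonneg[OF pF] fps_sqnorm_eq_0_iff[OF pF] \<open>p \<noteq> 0\<close> F0
        fps_of_poly_eq_iff[of p 0] by (auto simp: less_le)
    ultimately have "2 powr \<alpha> * fps_sqnorm \<alpha> G < (cmod \<zeta>)\<^sup>2 * fps_sqnorm \<alpha> G"
      using fps_sqnorm_X_mult_ge[OF \<alpha> G] by linarith
    then have "2 powr \<alpha> < (cmod \<zeta>)\<^sup>2"
      using fps_sqnorm_nonneg[OF G] by (simp add: mult_less_cancel_right)
    also have "2 powr \<alpha> = (2 powr (\<alpha> / 2))\<^sup>2"
      by (simp add: power2_eq_square flip: powr_add)
    finally show ?thesis
      by (rule power_less_imp_less_base) simp
  qed
  then show ?thesis
    by (fastforce simp: not_le)
qed

end
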